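(* Let $m>1$ be an odd integer. Then every positive integer $n$ satisfies $D_m(n)<n$.
   Context: For $m,n\in\mathbb{N}$, the Schemmel totient function $L_m(n)$ is the number of integers $k\in\{1,\dots,n\}$ such that $\gcd(k+s,n)=1$ for all $s\in\{0,1,\dots,m-1\}$; by convention $L_m(0)=0$. Equivalently, $L_m(1)=1$, and for $n>1$ with $n=\prod_{i=1}^r p_i^{\alpha_i}$, $L_m(n)=0$ if the smallest prime factor of $n$ is $\le m$, and $L_m(n)=\prod_{i} p_i^{\alpha_i-1}(p_i-m)$ otherwise. Iterates: $f^{(1)}=f$, $f^{(k+1)}=f\circ f^{(k)}$. $R_m(n)$ is the least positive integer $k$ with $L_m^{(k)}(n)\in\{0,1\}$. Define $D_m(1)=0$ and $D_m(n)=\sum_{i=1}^{R_m(n)}L_m^{(i)}(n)$ for $n>1$. *)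

theory Defs
  imports Main
begin

text \<open>The counting set is empty for \<open>n = 0\<close>, which gives the convention \<open>L\<^sub>m(0) = 0\<close>.\<close>

definition schemmel :: "nat \<Rightarrow> nat \<Rightarrow> nat" where
  "schemmel m n = card {k \<in> {1..n}. \<forall>s<m. gcd (k + s) n = 1}"

text \<open>
  For \<open>m \<ge> 1\<close> and \<open>n > 1\<close> we have \<open>L\<^sub>m(n) < n\<close>, so the least element below exists for every \<open>n\<close>.
  For \<open>m = 0\<close> (where \<open>L\<^sub>0(n) = n\<close>) and \<open>n > 1\<close> it does not, and the value is unspecified.
\<close>

definition schemmel_R :: "nat \<Rightarrow> nat \<Rightarrow> nat" where
  "schemmel_R m n = (LEAST k. k > 0 \<and> (schemmel m ^^ k) n \<in> {0, 1})"

text \<open>The value at \<open>n = 0\<close> is a convention; the notion is meant for positive \<open>n\<close>.\<close>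

definition schemmel_D :: "nat \<Rightarrow> nat \<Rightarrow> nat" where
  "schemmel_D m n = (if n > 1 then \<Sum>i = 1..schemmel_R m n. (schemmel m ^^ i) n else 0)"

end

theory Submission
  imports Defs
begin

text \<open>
  For \<open>n > 1\<close> no counted \<open>k\<close> satisfies \<open>k + m > n\<close>, because \<open>n\<close> would lie in the window
  \<open>k, \<dots>, k + m - 1\<close>. Reflecting windows at \<open>n/2\<close> is therefore an involution
  \<open>k \<mapsto> n - m + 1 - k\<close> of the counted set, and it has no fixed point when \<open>n\<close> and \<open>m\<close> are odd, so
  \<open>L\<^sub>m(n)\<close> is even. As \<open>L\<^sub>m\<close> vanishes at even arguments for \<open>m \<ge> 2\<close>, the second iterate is already
  \<open>0\<close>, and \<open>D\<^sub>m(n) = L\<^sub>m(n) < n\<close>.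
\<close>

text \<open>\<open>f\<close> swaps the points it moves up with those it moves down, and these two
  halves exhaust \<open>S\<close>. The linear order only serves to pick one point from each
  orbit.\<close>

lemma card_even_involution:
  fixes f :: "'a :: linorder \<Rightarrow> 'a"
  assumes "finite S"
    and maps: "\<And>x. x \<in> S \<Longrightarrow> f x \<in> S"
    and invol: "\<And>x. x \<in> S \<Longrightarrow> f (f x) = x"
    and nofix: "\<And>x. x \<in> S \<Longrightarrow> f x \<noteq> x"
  shows "even (card S)"
proof -
  define A where "A = {x \<in> S. x < f x}"
  define B where "B = {x \<in> S. f x < x}"
  have "bij_betw f A B"
    by (rule bij_betw_byWitness[where f' = f]) (auto simp: A_def B_def maps invol)
  then have "card A = card B"
    by (rule bij_betw_same_card)
  moreover have "S = A \<union> B"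
    using nofix by (force simp: A_def B_def)
  moreover have "A \<inter> B = {}"
    by (auto simp: A_def B_def)
  moreover have "finite A" "finite B"
    using \<open>finite S\<close> by (auto simp: A_def B_def)
  ultimately have "card S = 2 * card A"
    by (simp add: card_Un_disjoint)
  then show ?thesis
    by simp
qed

lemma schemmel_window_le:
  fixes k m n :: nat
  assumes "n > 1" and "k \<le> n" and "\<forall>s<m. gcd (k + s) n = 1"
  shows "k + m \<le> n"
proof (rule ccontr)
  assume "\<not> k + m \<le> n"
  then have "n - k < m"
    using \<open>k \<le> n\<close> by simp
  then have "gcd (k + (n - k)) n = 1"
    using assms(3) by blast
  then show False
    using assms by simp
qed

lemma schemmel_even_arg:
  assumes "m > 1" and "even n"
  shows "schemmel m n = 0"
proof -
  have "\<exists>s<m. gcd (k + s) n \<noteq> 1" for k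
  proof -
    \<comment> \<open>Of two consecutive integers one is even; this is its offset in the
      window.\<close>
    define s :: nat where "s = k mod 2"
    have "even (k + s)" "s < m"
      using \<open>m > 1\<close> by (auto simp: s_def mod_2_eq_odd)
    then show ?thesis
      using \<open>even n\<close> by (metis gcd_greatest odd_one)
  qed
  then have "{k \<in> {1..n}. \<forall>s<m. gcd (k + s) n = 1} = {}"
    by blast
  then show ?thesis
    unfolding schemmel_def by (simp only: card.empty)
qed

lemma schemmel_less:
  assumes "m > 0" and "n > 1"
  shows "schemmel m n < n"
proof -
  \<comment> \<open>A nonempty window must end before \<open>n\<close>, which rules out
    \<open>k = n\<close>.\<close>
  have "{k \<in> {1..n}. \<forall>s<m. gcd (k + s) n = 1} \<subseteq> {1..n - 1}"
    using schemmel_window_le[OF \<open>n > 1\<close>] \<open>m > 0\<close> by fastforce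
  then have "schemmel m n \<le> card {1..n - 1}"
    unfolding schemmel_def by (intro card_mono) auto
  then show ?thesis
    using \<open>n > 1\<close> by simp
qed

lemma even_schemmel:
  assumes "m > 1" and "odd m" and "n > 1"
  shows "even (schemmel m n)"
proof (cases "even n")
  case True
  then show ?thesis
    using schemmel_even_arg[OF \<open>m > 1\<close>] by simp
next
  case False
  define S where "S = {k \<in> {1..n}. \<forall>s<m. gcd (k + s) n = 1}"
  have le: "k + m \<le> n" if "k \<in> S" for k
    using that schemmel_window_le[OF \<open>n > 1\<close>] by (auto simp: S_def)
  have "even (card S)"
  proof (rule card_even_involution[where f = "\<lambda>k. n + 1 - (k + m)"])
    show "finite S"
      by (simp add: S_def)
  next
    fix k assume k: "k \<in> S"
    have "gcd (n + 1 - (k + m) + s) n = 1" if "s < m" for s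
    proof -
      \<comment> \<open>The map \<open>x \<mapsto> n - x\<close> preserves the gcd with
        \<open>n\<close> and reverses the window, so offset \<open>s\<close> comes from offset
        \<open>m - 1 - s\<close>. By \<open>le\<close> no subtraction is truncated.\<close>
      have eq: "n + 1 - (k + m) + s = n - (k + (m - 1 - s))"
        using le[OF k] that by simp
      have "gcd (k + (m - 1 - s)) n = 1"
      proof -
        have "m - 1 - s < m"
          using that by simp
        then show ?thesis
          using k unfolding S_def by blast
      qed
      moreover have "k + (m - 1 - s) \<le> n"
        using le[OF k] that by simp
      ultimately show ?thesis
        unfolding eq by (simp only: gcd_diff2_nat)
    qed
    then show "n + 1 - (k + m) \<in> S"
      using le[OF k] k \<open>m > 1\<close> by (auto simp: S_def)
    show "n + 1 - (n + 1 - (k + m) + m) = k"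
      using le[OF k] by simp
    show "n + 1 - (k + m) \<noteq> k"
    proof
      assume "n + 1 - (k + m) = k"
      then have "n + 1 = 2 * k + m"
        using le[OF k] by simp
      then show False
        using False \<open>odd m\<close> by presburger
    qed
  qed
  then show ?thesis
    by (simp add: schemmel_def S_def)
qed

theorem theorem2p1:
  fixes m n :: nat
  assumes "m > 1" and "odd m" and "n > 0"
  shows "schemmel_D m n < n"
proof (cases "n > 1")
  case True
  have second: "schemmel m (schemmel m n) = 0"
    using schemmel_even_arg even_schemmel assms True by blast
  \<comment> \<open>Only a bound: the value is 1 when \<open>schemmel m n = 0\<close>. Extending the
    sum to two terms can only enlarge it.\<close>
  have "schemmel_R m n \<le> 2"
    unfolding schemmel_R_def by (rule Least_le) (simp add: numeral_2_eq_2 second)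
  then have "(\<Sum>i = 1..schemmel_R m n. (schemmel m ^^ i) n) \<le> (\<Sum>i = 1..2. (schemmel m ^^ i) n)"
    by (intro sum_mono2) auto
  also have "\<dots> = schemmel m n"
    by (simp add: numeral_2_eq_2 second)
  also have "\<dots> < n"
    using schemmel_less assms True by simp
  finally show ?thesis
    using True by (simp add: schemmel_D_def)
next
  case False
  then show ?thesis
    using \<open>n > 0\<close> by (simp add: schemmel_D_def)
qed

end
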